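(* Let $G$ be a group such that $G$ is the normal closure of a finitely generated subgroup of $G$, and suppose that $G$ has a maximal normal subgroup. Then the set $\mathcal{N}^+(G)$ of proper normal subgroups of $G$, endowed with the coarse lower topology, is a spectral space.
   Context: For a group $G$, $\mathcal{N}(G)$ denotes the set of all normal subgroups of $G$ (including $G$ itself), and $\mathcal{N}^+(G)=\mathcal{N}(G)\setminus\{G\}$ denotes the set of proper normal subgroups. A proper normal subgroup $M$ of $G$ is maximal if no proper normal subgroup of $G$ properly contains $M$. The normal closure of a subgroup $H$ of $G$ is the smallest normal subgroup of $G$ containing $H$. The coarse lower topology on $\mathcal{N}(G)$ is the topology for which the sets $\mathcal{V}(S)=\{N\in\mathcal{N}(G)\mid S\subseteq N\}$, with $S\in\mathcal{N}(G)$, form a subbasis of closed sets (i.e. the coarsest topology in which all these sets are closed). The coarse lower topology on $\mathcal{N}^+(G)$ is the subspace topology induced from $\mathcal{N}(G)$. A topological space is quasi-compact if every open cover of it has a finite subcover (no separation axiom is assumed). A closed subset $S$ of a space $X$ is irreducible if $S\neq\emptyset$ and $S$ is not the union of two properly smaller closed subsets of $X$. A space $X$ is sober if every irreducible closed subset of $X$ is the closure of a unique singleton $\{x\}$, $x\in X$. A spectral space is a topological space that is quasi-compact, sober, and admits a basis of quasi-compact open subspaces that is closed under finite intersections. *)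

theory Defs
  imports "HOL-Analysis.Analysis" "HOL-Algebra.Generated_Groups"
begin

definition normal_subgroups :: "('a, 'b) monoid_scheme \<Rightarrow> 'a set set"
  where "normal_subgroups G = {N. N \<lhd> G}"

definition proper_normal_subgroups :: "('a, 'b) monoid_scheme \<Rightarrow> 'a set set"
  where "proper_normal_subgroups G = normal_subgroups G - {carrier G}"

definition maximal_normal_subgroup :: "'a set \<Rightarrow> ('a, 'b) monoid_scheme \<Rightarrow> bool"
  where "maximal_normal_subgroup M G \<longleftrightarrow>
    M \<in> proper_normal_subgroups G \<and> \<not> (\<exists>N \<in> proper_normal_subgroups G. M \<subset> N)"

definition normal_closure :: "('a, 'b) monoid_scheme \<Rightarrow> 'a set \<Rightarrow> 'a set"
  where "normal_closure G H = (\<lambda>N. N \<lhd> G) hull H"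

definition finitely_generated_subgroup :: "'a set \<Rightarrow> ('a, 'b) monoid_scheme \<Rightarrow> bool"
  where "finitely_generated_subgroup H G \<longleftrightarrow>
    subgroup H G \<and> (\<exists>A. finite A \<and> A \<subseteq> carrier G \<and> H = generate G A)"

definition normal_subgroups_above :: "('a, 'b) monoid_scheme \<Rightarrow> 'a set \<Rightarrow> 'a set set"
  where "normal_subgroups_above G S = {N \<in> normal_subgroups G. S \<subseteq> N}"

text \<open>The complements of the subbasic closed sets cover every point except \<open>carrier G\<close>, so the
  intersections are taken relative to \<open>normal_subgroups G\<close>: the empty one is then the whole set.\<close>

definition coarse_lower_topology :: "('a, 'b) monoid_scheme \<Rightarrow> 'a set topology"
  where "coarse_lower_topology G = topology (arbitrary union_of
    (finite intersection_of
      (\<lambda>U. \<exists>S \<in> normal_subgroups G. U = normal_subgroups G - normal_subgroups_above G S)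
      relative_to normal_subgroups G))"

lemma topspace_coarse_lower_topology [simp]:
  "topspace (coarse_lower_topology G) = normal_subgroups G"
  unfolding coarse_lower_topology_def by (rule topspace_subbase)

lemma closedin_coarse_lower_topology_above:
  assumes "S \<in> normal_subgroups G"
  shows "closedin (coarse_lower_topology G) (normal_subgroups_above G S)"
proof -
  let ?U = "normal_subgroups G - normal_subgroups_above G S"
  have "openin (coarse_lower_topology G) (normal_subgroups G \<inter> ?U)"
    unfolding coarse_lower_topology_def openin_subbase using assms
    by (intro union_of_inc relative_to_inc intersection_of_inc) (auto simp: arbitrary_def)
  moreover have "normal_subgroups G \<inter> ?U = ?U" by blast
  ultimately show ?thesis
    by (auto simp: closedin_def normal_subgroups_above_def)
qed

lemma coarse_lower_topology_coarsest:
  assumes X: "topspace X = normal_subgroups G"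
    and cl: "\<And>S. S \<in> normal_subgroups G \<Longrightarrow> closedin X (normal_subgroups_above G S)"
    and U: "openin (coarse_lower_topology G) U"
  shows "openin X U"
proof (rule minimal_topology_subbase)
  show "openin (topology (arbitrary union_of (finite intersection_of
      (\<lambda>U. \<exists>S \<in> normal_subgroups G. U = normal_subgroups G - normal_subgroups_above G S)
      relative_to normal_subgroups G))) U"
    using U unfolding coarse_lower_topology_def .
  show "openin X (normal_subgroups G)" using openin_topspace[of X] X by simp
qed (use X cl in \<open>auto simp: closedin_def\<close>)

definition irreducible_closedin :: "'a topology \<Rightarrow> 'a set \<Rightarrow> bool"
  where "irreducible_closedin X S \<longleftrightarrow> closedin X S \<and> S \<noteq> {} \<and>
    \<not> (\<exists>A B. closedin X A \<and> closedin X B \<and> A \<subset> S \<and> B \<subset> S \<and> S = A \<union> B)"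

definition sober_space :: "'a topology \<Rightarrow> bool"
  where "sober_space X \<longleftrightarrow>
    (\<forall>S. irreducible_closedin X S \<longrightarrow> (\<exists>!x. x \<in> topspace X \<and> S = X closure_of {x}))"

text \<open>Finite intersections include the empty one, which is the whole space.\<close>

definition spectral_space :: "'a topology \<Rightarrow> bool"
  where "spectral_space X \<longleftrightarrow> compact_space X \<and> sober_space X \<and>
    (\<exists>\<B>. openin X = arbitrary union_of (\<lambda>U. U \<in> \<B>) \<and>
         (\<forall>U \<in> \<B>. compactin X U) \<and>
         (\<forall>\<F>. finite \<F> \<and> \<F> \<subseteq> \<B> \<longrightarrow> topspace X \<inter> \<Inter>\<F> \<in> \<B>))"

end

theory Submission
  imports Defs
begin

text \<open>
  The lattice operations on normal subgroups enter the proof only through two closure properties of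
  the family \<open>C\<close> of proper normal subgroups, viewed as a family of subsets of the group: it is
  closed under intersections of nonempty subfamilies and under unions of nonempty directed
  subfamilies. For the second one, a directed union of normal subgroups is always a normal subgroup;
  if it were the whole group, then one member would already contain the finitely many elements
  whose normal closure is the group, hence would not be proper.

  Any family \<open>C\<close> of sets with these two properties is spectral for the topology whose basic open
  sets are the families \<open>avoiding C A\<close> of members disjoint from a finite set \<open>A\<close>
  (\<open>spectral_space_hull_kernel\<close>):

  \<^item> The basic open sets are closed under finite intersections by construction. Each of them
    has the same two closure properties as \<open>C\<close>, so their compactness reduces to that of \<open>C\<close>
    itself. By Alexander's theorem only covers by the sets \<open>avoiding C {b}\<close>, \<open>b \<in> B\<close>, matter. If no
    finite part of such a cover suffices, then every finite subset of \<open>B\<close> lies in a member of \<open>C\<close>;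
    the smallest such members form a directed system, and their union is a member of \<open>C\<close>
    containing \<open>B\<close>, which the cover misses.

  \<^item> The closure of \<open>{N}\<close> consists of the members containing \<open>N\<close>, so generic points are unique.
    The generic point of an irreducible closed set \<open>S\<close> is \<open>\<Inter>S\<close>: a basic neighbourhood
    \<open>avoiding C A\<close> of \<open>\<Inter>S\<close> that misses \<open>S\<close> would cover \<open>S\<close> by the finitely many
    closed sets of members containing a given \<open>a \<in> A\<close>, and none of these contains \<open>S\<close>.

  On normal subgroups this topology is the coarse lower topology, because \<open>S \<subseteq> N\<close> fails exactly when
  some \<open>x \<in> S\<close> is avoided by \<open>N\<close>, and avoiding an element \<open>x\<close> of the group is the same as not
  containing the normal closure of \<open>x\<close>.
\<close>

section \<open>The hull-kernel topology on a family of sets\<close>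

definition avoiding :: "'a set set \<Rightarrow> 'a set \<Rightarrow> 'a set set"
  where "avoiding C A = {N \<in> C. N \<inter> A = {}}"

lemma avoiding_empty [simp]: "avoiding C {} = C"
  by (simp add: avoiding_def)

lemma avoiding_subset: "avoiding C A \<subseteq> C"
  by (auto simp: avoiding_def)

lemma avoiding_Un: "avoiding C (A \<union> B) = avoiding C A \<inter> avoiding C B"
  by (auto simp: avoiding_def)

text \<open>The name is the one used for spaces of prime ideals: closures are hulls of kernels. Giving the
  open sets through the basis \<open>avoiding C A\<close> lets the topology restrict well: the subspace
  topology on a subfamily is again of this form.\<close>

definition hull_kernel_topology :: "'a set set \<Rightarrow> 'a set topology"
  where "hull_kernel_topology C = topology (\<lambda>W. W \<subseteq> C \<and>
    (\<forall>N\<in>W. \<exists>A. finite A \<and> N \<in> avoiding C A \<and> avoiding C A \<subseteq> W))"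

lemma openin_hull_kernel:
  "openin (hull_kernel_topology C) W \<longleftrightarrow> W \<subseteq> C \<and>
    (\<forall>N\<in>W. \<exists>A. finite A \<and> N \<in> avoiding C A \<and> avoiding C A \<subseteq> W)"
proof -
  let ?P = "\<lambda>W. W \<subseteq> C \<and> (\<forall>N\<in>W. \<exists>A. finite A \<and> N \<in> avoiding C A \<and> avoiding C A \<subseteq> W)"
  have "istopology ?P"
    unfolding istopology_def
  proof (intro conjI allI impI)
    fix S T assume S: "?P S" and T: "?P T"
    show "S \<inter> T \<subseteq> C" using S by blast
    show "\<forall>N\<in>S \<inter> T. \<exists>A. finite A \<and> N \<in> avoiding C A \<and> avoiding C A \<subseteq> S \<inter> T"
    proof
      fix N assume N: "N \<in> S \<inter> T"
      obtain A where "finite A" "N \<in> avoiding C A" "avoiding C A \<subseteq> S" using S N by blast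
      moreover obtain B where "finite B" "N \<in> avoiding C B" "avoiding C B \<subseteq> T" using T N by blast
      ultimately have "finite (A \<union> B) \<and> N \<in> avoiding C (A \<union> B) \<and> avoiding C (A \<union> B) \<subseteq> S \<inter> T"
        by (auto simp: avoiding_Un)
      then show "\<exists>A. finite A \<and> N \<in> avoiding C A \<and> avoiding C A \<subseteq> S \<inter> T" ..
    qed
  next
    fix K assume K: "\<forall>S\<in>K. ?P S"
    show "\<Union>K \<subseteq> C" using K by blast
    show "\<forall>N\<in>\<Union>K. \<exists>A. finite A \<and> N \<in> avoiding C A \<and> avoiding C A \<subseteq> \<Union>K"
    proof
      fix N assume "N \<in> \<Union>K"
      then obtain S where "S \<in> K" "N \<in> S" by blast
      moreover then obtain A where "finite A" "N \<in> avoiding C A" "avoiding C A \<subseteq> S"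
        using K by blast
      ultimately show "\<exists>A. finite A \<and> N \<in> avoiding C A \<and> avoiding C A \<subseteq> \<Union>K" by blast
    qed
  qed
  then show ?thesis
    by (simp add: hull_kernel_topology_def topology_inverse')
qed

lemma openin_avoiding: "finite A \<Longrightarrow> openin (hull_kernel_topology C) (avoiding C A)"
  by (auto simp: openin_hull_kernel intro: avoiding_subset[THEN subsetD])

lemma topspace_hull_kernel [simp]: "topspace (hull_kernel_topology C) = C"
proof
  show "topspace (hull_kernel_topology C) \<subseteq> C"
    by (metis openin_hull_kernel openin_topspace)
  show "C \<subseteq> topspace (hull_kernel_topology C)"
    using openin_avoiding[of "{}" C] openin_subset by force
qed

lemma openin_hull_kernel_basis:
  "openin (hull_kernel_topology C) = arbitrary union_of (\<lambda>U. U \<in> {avoiding C A |A. finite A})"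
proof
  fix W
  show "openin (hull_kernel_topology C) W
    = (arbitrary union_of (\<lambda>U. U \<in> {avoiding C A |A. finite A})) W"
  proof
    assume "openin (hull_kernel_topology C) W"
    then show "(arbitrary union_of (\<lambda>U. U \<in> {avoiding C A |A. finite A})) W"
      unfolding arbitrary_union_of_alt openin_hull_kernel by (metis (mono_tags, lifting) mem_Collect_eq)
  next
    assume "(arbitrary union_of (\<lambda>U. U \<in> {avoiding C A |A. finite A})) W"
    then show "openin (hull_kernel_topology C) W"
      unfolding union_of_def by (auto intro!: openin_Union openin_avoiding)
  qed
qed

lemma subtopology_hull_kernel:
  assumes "D \<subseteq> C"
  shows "subtopology (hull_kernel_topology C) D = hull_kernel_topology D"
proof -
  have D: "avoiding D A = avoiding C A \<inter> D" for A
    using assms by (auto simp: avoiding_def)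
  show ?thesis
    unfolding topology_eq
  proof (intro allI iffI)
    fix W assume "openin (subtopology (hull_kernel_topology C) D) W"
    then obtain T where T: "openin (hull_kernel_topology C) T" "W = T \<inter> D"
      by (auto simp: openin_subtopology)
    show "openin (hull_kernel_topology D) W"
      unfolding openin_hull_kernel
    proof (intro conjI ballI)
      fix N assume N: "N \<in> W"
      then obtain A where "finite A" "N \<in> avoiding C A" "avoiding C A \<subseteq> T"
        using T unfolding openin_hull_kernel by blast
      then show "\<exists>A. finite A \<and> N \<in> avoiding D A \<and> avoiding D A \<subseteq> W"
        using N T(2) by (auto simp: D)
    qed (use T in blast)
  next
    fix W assume W: "openin (hull_kernel_topology D) W"
    let ?T = "\<Union>{avoiding C A |A. finite A \<and> avoiding D A \<subseteq> W}"
    have "openin (hull_kernel_topology C) ?T"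
      using openin_avoiding by blast
    moreover have "W = ?T \<inter> D"
    proof
      show "W \<subseteq> ?T \<inter> D"
      proof
        fix N assume N: "N \<in> W"
        then obtain A where "finite A" "N \<in> avoiding D A" "avoiding D A \<subseteq> W"
          using W unfolding openin_hull_kernel by blast
        then show "N \<in> ?T \<inter> D"
          by (auto simp: D)
      qed
      show "?T \<inter> D \<subseteq> W"
        by (auto simp: D)
    qed
    ultimately show "openin (subtopology (hull_kernel_topology C) D) W"
      unfolding openin_subtopology by blast
  qed
qed

text \<open>Alexander's theorem asks for a subbase that covers the space. A member of \<open>C\<close> equal to \<open>UNIV\<close>
  avoids no point, so \<open>C\<close> itself is added to the subbase.\<close>

lemma hull_kernel_subbase:
  "topology (arbitrary union_of
      (finite intersection_of (\<lambda>U. U \<in> insert C {avoiding C {x} |x. True}) relative_to C))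
    = hull_kernel_topology C" (is "?X = _")
  unfolding topology_eq
proof (intro allI iffI)
  fix W assume "openin ?X W"
  then show "openin (hull_kernel_topology C) W"
  proof (rule minimal_topology_subbase[rotated 2])
    show "openin (hull_kernel_topology C) C"
      by (metis openin_topspace topspace_hull_kernel)
    then show "openin (hull_kernel_topology C) U"
      if "U \<in> insert C {avoiding C {x} |x. True}" for U
      using that by (auto intro: openin_avoiding)
  qed
next
  fix W assume W: "openin (hull_kernel_topology C) W"
  have top: "openin ?X C"
    by (metis openin_topspace topspace_subbase)
  have pt: "openin ?X (avoiding C {x})" for x
  proof -
    have "openin ?X (C \<inter> avoiding C {x})"
      unfolding openin_subbase
      by (intro union_of_inc relative_to_inc intersection_of_inc) (auto simp: arbitrary_def)
    moreover have "C \<inter> avoiding C {x} = avoiding C {x}" using avoiding_subset by blast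
    ultimately show ?thesis by simp
  qed
  have basic: "openin ?X (avoiding C A)" if "finite A" for A
    using that
  proof induction
    case (insert x A)
    then show ?case
      using avoiding_Un[of C "{x}" A] openin_Int[OF pt] by simp
  qed (simp only: avoiding_empty top)
  show "openin ?X W"
    unfolding openin_subopen[of ?X W]
  proof
    fix N assume "N \<in> W"
    then obtain A where "finite A" "N \<in> avoiding C A" "avoiding C A \<subseteq> W"
      using W unfolding openin_hull_kernel by blast
    then show "\<exists>T. openin ?X T \<and> N \<in> T \<and> T \<subseteq> W"
      using basic by blast
  qed
qed


section \<open>Sobriety\<close>

lemma closedin_containing: "closedin (hull_kernel_topology C) {M \<in> C. x \<in> M}"
proof -
  have "C - {M \<in> C. x \<in> M} = avoiding C {x}" by (auto simp: avoiding_def)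
  then show ?thesis by (simp add: closedin_def openin_avoiding)
qed

lemma closure_of_singleton_hull_kernel:
  assumes "N \<in> C"
  shows "hull_kernel_topology C closure_of {N} = {M \<in> C. N \<subseteq> M}"
proof (intro equalityI subsetI)
  fix M assume M: "M \<in> hull_kernel_topology C closure_of {N}"
  have "N \<subseteq> M"
  proof
    fix x assume x: "x \<in> N"
    show "x \<in> M"
    proof (rule ccontr)
      assume "x \<notin> M"
      then have "M \<in> avoiding C {x}" using M by (auto simp: in_closure_of avoiding_def)
      then have "N \<in> avoiding C {x}"
        using M openin_avoiding[of "{x}" C] unfolding in_closure_of by blast
      then show False using x by (simp add: avoiding_def)
    qed
  qed
  then show "M \<in> {M \<in> C. N \<subseteq> M}" using M by (simp add: in_closure_of)
next
  fix M assume M: "M \<in> {M \<in> C. N \<subseteq> M}"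
  have "N \<in> T" if T: "openin (hull_kernel_topology C) T" "M \<in> T" for T
  proof -
    obtain A where "M \<in> avoiding C A" "avoiding C A \<subseteq> T"
      using T unfolding openin_hull_kernel by blast
    moreover then have "N \<in> avoiding C A" using M assms by (auto simp: avoiding_def)
    ultimately show ?thesis by blast
  qed
  then show "M \<in> hull_kernel_topology C closure_of {N}"
    using M by (auto simp: in_closure_of)
qed

lemma irreducible_closedin_subset_Union:
  assumes S: "irreducible_closedin X S"
    and "finite F" "\<And>K. K \<in> F \<Longrightarrow> closedin X K" "S \<subseteq> \<Union>F"
  shows "\<exists>K\<in>F. S \<subseteq> K"
  using assms(2-)
proof (induction F)
  case empty
  then show ?case using S by (auto simp: irreducible_closedin_def)
next
  case (insert K F)
  show ?case
  proof (cases "S \<subseteq> K \<or> S \<subseteq> \<Union>F")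
    case True
    then show ?thesis using insert by auto
  next
    case False
    have "closedin X (S \<inter> K)" "closedin X (S \<inter> \<Union>F)"
      using S insert by (auto simp: irreducible_closedin_def intro!: closedin_Int closedin_Union)
    moreover have "S \<inter> K \<subset> S" "S \<inter> \<Union>F \<subset> S" using False by auto
    moreover have "S = (S \<inter> K) \<union> (S \<inter> \<Union>F)" using insert.prems by auto
    ultimately show ?thesis using S unfolding irreducible_closedin_def by blast
  qed
qed

lemma sober_space_hull_kernel:
  assumes Inter: "\<And>D. D \<subseteq> C \<Longrightarrow> D \<noteq> {} \<Longrightarrow> \<Inter>D \<in> C"
  shows "sober_space (hull_kernel_topology C)"
  unfolding sober_space_def
proof (intro allI impI)
  let ?X = "hull_kernel_topology C"
  fix S assume S: "irreducible_closedin ?X S"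
  then have cl: "closedin ?X S" and ne: "S \<noteq> {}" by (auto simp: irreducible_closedin_def)
  have sub: "S \<subseteq> C" using closedin_subset[OF cl] by simp
  then have P: "\<Inter>S \<in> C" using Inter ne by blast
  have "\<Inter>S \<in> S"
  proof (rule ccontr)
    assume "\<Inter>S \<notin> S"
    moreover have "openin ?X (C - S)" using cl by (simp add: closedin_def)
    ultimately obtain A where A: "finite A" "\<Inter>S \<in> avoiding C A" "avoiding C A \<subseteq> C - S"
      using P unfolding openin_hull_kernel by blast
    \<comment> \<open>Every member of \<open>S\<close> meets \<open>A\<close>; irreducibility turns this into one common point
      of \<open>A\<close> in all of them.\<close>
    let ?F = "(\<lambda>a. {M \<in> C. a \<in> M}) ` A"
    have "S \<subseteq> \<Union>?F" using A(3) sub by (auto simp: avoiding_def)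
    then have "\<exists>K\<in>?F. S \<subseteq> K"
      using A(1) closedin_containing by (intro irreducible_closedin_subset_Union[OF S]) auto
    then obtain a where "a \<in> A" "S \<subseteq> {M \<in> C. a \<in> M}" by blast
    then have "a \<in> \<Inter>S \<inter> A" by blast
    then show False using A(2) unfolding avoiding_def by blast
  qed
  then have "hull_kernel_topology C closure_of {\<Inter>S} \<subseteq> S"
    using cl by (intro closure_of_minimal) auto
  moreover have "S \<subseteq> {M \<in> C. \<Inter>S \<subseteq> M}" using sub by blast
  ultimately have eq: "S = ?X closure_of {\<Inter>S}"
    by (simp add: closure_of_singleton_hull_kernel[OF P])
  show "\<exists>!N. N \<in> topspace ?X \<and> S = ?X closure_of {N}"
  proof (intro ex1I conjI)
    fix N assume "N \<in> topspace ?X \<and> S = ?X closure_of {N}"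
    then have "N \<in> C" "S = {M \<in> C. N \<subseteq> M}"
      by (simp_all add: closure_of_singleton_hull_kernel)
    then show "N = \<Inter>S" by blast
  qed (use eq P in simp_all)
qed


section \<open>Compactness and spectrality\<close>

definition directed_family :: "'a set set \<Rightarrow> bool"
  where "directed_family D \<longleftrightarrow> D \<noteq> {} \<and> (\<forall>M\<in>D. \<forall>N\<in>D. \<exists>K\<in>D. M \<union> N \<subseteq> K)"

lemma finite_subset_directed_Union:
  assumes D: "directed_family D" and "finite A" "A \<subseteq> \<Union>D"
  shows "\<exists>K\<in>D. A \<subseteq> K"
  using assms(2,3)
proof (induction A)
  case empty
  then show ?case using D by (auto simp: directed_family_def)
next
  case (insert x A)
  then obtain K where "K \<in> D" "A \<subseteq> K" by auto
  moreover obtain M where "M \<in> D" "x \<in> M" using insert.prems by auto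
  moreover obtain L where "L \<in> D" "K \<union> M \<subseteq> L"
    using D \<open>K \<in> D\<close> \<open>M \<in> D\<close> unfolding directed_family_def by blast
  ultimately show ?case by blast
qed

text \<open>The set \<open>B\<close> below collects the points whose avoiding families belong to the cover. A member of
  \<open>C\<close> is missed by all of these families exactly when it contains \<open>B\<close>, so compactness amounts
  to building such a member out of members containing the finite subsets of \<open>B\<close>.\<close>

lemma compact_space_hull_kernel:
  assumes Inter: "\<And>D. D \<subseteq> C \<Longrightarrow> D \<noteq> {} \<Longrightarrow> \<Inter>D \<in> C"
    and Union: "\<And>D. D \<subseteq> C \<Longrightarrow> directed_family D \<Longrightarrow> \<Union>D \<in> C"
  shows "compact_space (hull_kernel_topology C)"
proof (rule Alexander_subbase_alt[OF _ _ hull_kernel_subbase])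
  show "C \<subseteq> \<Union>(insert C {avoiding C {x} |x. True})" by blast
next
  fix \<U> assume \<U>: "\<U> \<subseteq> insert C {avoiding C {x} |x. True}" and cover: "C \<subseteq> \<Union>\<U>"
  show "\<exists>\<U>'. finite \<U>' \<and> \<U>' \<subseteq> \<U> \<and> C \<subseteq> \<Union>\<U>'"
  proof (cases "C \<in> \<U>")
    case True
    then show ?thesis by (intro exI[of _ "{C}"]) auto
  next
    case False
    define B where "B = {b. avoiding C {b} \<in> \<U>}"
    show ?thesis
    proof (rule ccontr)
      assume none: "\<nexists>\<U>'. finite \<U>' \<and> \<U>' \<subseteq> \<U> \<and> C \<subseteq> \<Union>\<U>'"
      have ex: "\<exists>N\<in>C. F \<subseteq> N" if "finite F" "F \<subseteq> B" for F
      proof -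
        let ?\<F> = "(\<lambda>b. avoiding C {b}) ` F"
        have "finite ?\<F>" "?\<F> \<subseteq> \<U>" using that by (auto simp: B_def)
        then have "\<not> C \<subseteq> \<Union>?\<F>" using none by metis
        then show ?thesis by (auto simp: avoiding_def)
      qed
      \<comment> \<open>Arbitrary members containing the finite sets need not form a directed family; the
        smallest ones do, because they depend monotonically on the finite set.\<close>
      define h where "h F = \<Inter>{N \<in> C. F \<subseteq> N}" for F
      have h_in: "h F \<in> C" if "finite F" "F \<subseteq> B" for F
        unfolding h_def using ex[OF that] by (intro Inter) auto
      have h_mono: "h F \<subseteq> h F'" if "F \<subseteq> F'" for F F'
        unfolding h_def using that by blast
      let ?D = "h ` {F. finite F \<and> F \<subseteq> B}"
      have "directed_family ?D"
        unfolding directed_family_def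
      proof (intro conjI ballI)
        fix M N assume "M \<in> ?D" "N \<in> ?D"
        then obtain F F' where "finite F" "F \<subseteq> B" "M = h F" "finite F'" "F' \<subseteq> B" "N = h F'"
          by blast
        moreover then have "M \<union> N \<subseteq> h (F \<union> F')"
          using h_mono[of F "F \<union> F'"] h_mono[of F' "F \<union> F'"] by blast
        ultimately show "\<exists>K\<in>?D. M \<union> N \<subseteq> K"
          by (intro bexI[of _ "h (F \<union> F')"]) auto
      qed blast
      then have P: "\<Union>?D \<in> C" using h_in by (intro Union) auto
      have "B \<subseteq> \<Union>?D"
      proof
        fix b assume "b \<in> B"
        moreover have "b \<in> h {b}" by (auto simp: h_def)
        ultimately show "b \<in> \<Union>?D" by blast
      qed
      moreover obtain U where "U \<in> \<U>" "\<Union>?D \<in> U" using P cover by blast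
      moreover then obtain b where "U = avoiding C {b}" using \<U> False by blast
      ultimately show False by (auto simp: B_def avoiding_def)
    qed
  qed
qed

theorem spectral_space_hull_kernel:
  assumes Inter: "\<And>D. D \<subseteq> C \<Longrightarrow> D \<noteq> {} \<Longrightarrow> \<Inter>D \<in> C"
    and Union: "\<And>D. D \<subseteq> C \<Longrightarrow> directed_family D \<Longrightarrow> \<Union>D \<in> C"
  shows "spectral_space (hull_kernel_topology C)"
  unfolding spectral_space_def
proof (intro conjI exI)
  let ?X = "hull_kernel_topology C"
  let ?\<B> = "{avoiding C A |A. finite A}"
  show "compact_space ?X" using assms by (rule compact_space_hull_kernel)
  show "sober_space ?X" using Inter by (rule sober_space_hull_kernel)
  show "openin ?X = arbitrary union_of (\<lambda>U. U \<in> ?\<B>)" by (rule openin_hull_kernel_basis)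
  show "\<forall>U\<in>?\<B>. compactin ?X U"
  proof
    fix U assume "U \<in> ?\<B>"
    then obtain A where U: "U = avoiding C A" by blast
    \<comment> \<open>Avoiding \<open>A\<close> survives nonempty intersections and all unions, so the compactness criterion
      applies to the subfamily \<open>U\<close> just as it does to \<open>C\<close>.\<close>
    have "compact_space (hull_kernel_topology U)"
    proof (rule compact_space_hull_kernel)
      fix D assume D: "D \<subseteq> U"
      then have "D \<subseteq> C" using U avoiding_subset by blast
      then show "\<Inter>D \<in> U" if "D \<noteq> {}"
        using Inter[of D] that D by (auto simp: U avoiding_def)
      show "\<Union>D \<in> U" if "directed_family D"
        using Union[of D] that D \<open>D \<subseteq> C\<close> by (auto simp: U avoiding_def)
    qed
    then show "compactin ?X U"
      using U avoiding_subset[of C A] by (simp add: compactin_subspace subtopology_hull_kernel)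
  qed
  show "\<forall>\<F>. finite \<F> \<and> \<F> \<subseteq> ?\<B> \<longrightarrow> topspace ?X \<inter> \<Inter>\<F> \<in> ?\<B>"
  proof (intro allI impI, elim conjE)
    fix \<F> assume "finite \<F>" "\<F> \<subseteq> ?\<B>"
    then show "topspace ?X \<inter> \<Inter>\<F> \<in> ?\<B>"
    proof induction
      case empty
      show ?case using avoiding_empty[of C] by force
    next
      case (insert U \<F>)
      then obtain A A' where "finite A" "U = avoiding C A" "finite A'"
        "topspace ?X \<inter> \<Inter>\<F> = avoiding C A'" by auto
      moreover then have "topspace ?X \<inter> \<Inter>(insert U \<F>) = avoiding C (A \<union> A')"
        by (auto simp: avoiding_Un)
      ultimately show ?case by blast
    qed
  qed
qed


section \<open>Normal subgroups\<close>

lemma (in group) normal_Inter: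
  assumes "D \<noteq> {}" "\<And>N. N \<in> D \<Longrightarrow> N \<lhd> G"
  shows "\<Inter>D \<lhd> G"
proof (rule normal_invI)
  show "subgroup (\<Inter>D) G"
    using assms by (intro subgroups_Inter) (auto simp: normal_inv_iff)
  show "x \<otimes> h \<otimes> inv x \<in> \<Inter>D" if "x \<in> carrier G" "h \<in> \<Inter>D" for x h
    using that assms(2) normal_invE(2) by blast
qed

lemma (in group) normal_directed_Union:
  assumes D: "directed_family D" and norm: "\<And>N. N \<in> D \<Longrightarrow> N \<lhd> G"
  shows "\<Union>D \<lhd> G"
proof (rule normal_invI)
  have sub: "subgroup N G" if "N \<in> D" for N
    using norm[OF that] by (simp add: normal_inv_iff)
  show "subgroup (\<Union>D) G"
  proof (rule subgroupI)
    show "\<Union>D \<subseteq> carrier G" using sub subgroup.subset by blast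
    obtain N where "N \<in> D" using D by (auto simp: directed_family_def)
    then show "\<Union>D \<noteq> {}" using subgroup.one_closed[OF sub] by blast
    show "inv a \<in> \<Union>D" if "a \<in> \<Union>D" for a
      using that subgroup.m_inv_closed[OF sub] by blast
    show "a \<otimes> b \<in> \<Union>D" if ab: "a \<in> \<Union>D" "b \<in> \<Union>D" for a b
    proof -
      obtain K where "K \<in> D" "{a, b} \<subseteq> K"
        using finite_subset_directed_Union[OF D, of "{a, b}"] ab by auto
      then show ?thesis using subgroup.m_closed[OF sub] by blast
    qed
  qed
  show "x \<otimes> h \<otimes> inv x \<in> \<Union>D" if "x \<in> carrier G" "h \<in> \<Union>D" for x h
    using that norm normal_invE(2) by blast
qed

lemma (in group) normal_closure_normal:
  assumes "S \<subseteq> carrier G"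
  shows "normal_closure G S \<lhd> G"
proof -
  have "carrier G \<lhd> G" by (rule normal_invI[OF subgroup_self]) auto
  then show ?thesis
    unfolding normal_closure_def hull_def using assms by (intro normal_Inter) auto
qed

text \<open>The subbasic closed set of normal subgroups above \<open>S\<close> is the intersection, over the elements
  \<open>x\<close> of \<open>S\<close>, of the closed sets of normal subgroups containing \<open>x\<close>. Conversely, containing
  \<open>x\<close> means lying above the normal closure of \<open>x\<close>. So the two subbases generate the same
  topology.\<close>

lemma (in group) coarse_lower_topology_eq_hull_kernel:
  "coarse_lower_topology G = hull_kernel_topology (normal_subgroups G)" (is "_ = ?X")
  unfolding topology_eq
proof (intro allI iffI)
  let ?C = "normal_subgroups G"
  fix W assume W: "openin (coarse_lower_topology G) W"
  show "openin ?X W"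
  proof (rule coarse_lower_topology_coarsest[OF _ _ W])
    fix S
    have "closedin ?X (?C \<inter> (\<Inter>x\<in>S. {M \<in> ?C. x \<in> M}))"
    proof (cases "S = {}")
      case True
      then show ?thesis using closedin_topspace[of ?X] by simp
    next
      case False
      then show ?thesis
        using closedin_topspace[of ?X]
        by (intro closedin_Int closedin_Inter) (auto intro: closedin_containing)
    qed
    moreover have "?C \<inter> (\<Inter>x\<in>S. {M \<in> ?C. x \<in> M}) = normal_subgroups_above G S"
      by (auto simp: normal_subgroups_above_def)
    ultimately show "closedin ?X (normal_subgroups_above G S)" by simp
  qed simp
next
  let ?C = "normal_subgroups G"
  fix W assume W: "openin ?X W"
  have top: "openin (coarse_lower_topology G) ?C"
    by (metis openin_topspace topspace_coarse_lower_topology)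
  have pt: "openin (coarse_lower_topology G) (avoiding ?C {x})" for x
  proof (cases "x \<in> carrier G")
    case True
    then have norm: "normal_closure G {x} \<lhd> G" by (simp add: normal_closure_normal)
    have "x \<in> N \<longleftrightarrow> normal_closure G {x} \<subseteq> N" if "N \<lhd> G" for N
      using that hull_minimal[of "{x}" N "\<lambda>N. N \<lhd> G"] hull_subset[of "{x}" "\<lambda>N. N \<lhd> G"]
      unfolding normal_closure_def by blast
    then have "avoiding ?C {x} = ?C - normal_subgroups_above G (normal_closure G {x})"
      by (auto simp: avoiding_def normal_subgroups_def normal_subgroups_above_def)
    then show ?thesis
      using closedin_coarse_lower_topology_above[of "normal_closure G {x}" G] norm
      by (simp add: closedin_def normal_subgroups_def)
  next
    case False
    \<comment> \<open>The subbase is indexed by the whole type; a point outside the group is avoided by every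
      subgroup.\<close>
    then have "avoiding ?C {x} = ?C"
      by (auto simp: avoiding_def normal_subgroups_def normal_inv_iff dest: subgroup.subset)
    then show ?thesis using top by simp
  qed
  show "openin (coarse_lower_topology G) W"
  proof (rule minimal_topology_subbase[OF _ top])
    show "openin (topology (arbitrary union_of (finite intersection_of
      (\<lambda>U. U \<in> insert ?C {avoiding ?C {x} |x. True}) relative_to ?C))) W"
      using W by (simp only: hull_kernel_subbase)
  qed (use top pt in auto)
qed

text \<open>Finite generation makes the group a compact element of the lattice of its normal subgroups;
  this is what keeps directed unions proper.\<close>

lemma (in group) proper_normal_directed_Union:
  assumes H: "finitely_generated_subgroup H G" "carrier G = normal_closure G H"
    and D: "directed_family D" "D \<subseteq> proper_normal_subgroups G"
  shows "\<Union>D \<in> proper_normal_subgroups G"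
proof -
  have norm: "N \<lhd> G" if "N \<in> D" for N
    using that D(2) by (auto simp: proper_normal_subgroups_def normal_subgroups_def)
  have "\<Union>D \<noteq> carrier G"
  proof
    assume top: "\<Union>D = carrier G"
    obtain A where A: "finite A" "A \<subseteq> carrier G" "H = generate G A"
      using H(1) by (auto simp: finitely_generated_subgroup_def)
    then obtain K where K: "K \<in> D" "A \<subseteq> K"
      using finite_subset_directed_Union[OF D(1)] top by metis
    have "subgroup K G" using norm[OF K(1)] by (simp add: normal_inv_iff)
    then have "H \<subseteq> K" using A(3) K(2) generate_subgroup_incl by blast
    then have "carrier G \<subseteq> K"
      using H(2) norm[OF K(1)] hull_minimal[of H K "\<lambda>N. N \<lhd> G"]
      by (simp add: normal_closure_def)
    then have "K = carrier G" using \<open>subgroup K G\<close> subgroup.subset by blast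
    then show False using K(1) D(2) by (auto simp: proper_normal_subgroups_def)
  qed
  then show ?thesis
    using normal_directed_Union[OF D(1) norm]
    by (simp add: proper_normal_subgroups_def normal_subgroups_def)
qed

lemma (in group) proper_normal_Inter:
  assumes "D \<subseteq> proper_normal_subgroups G" "D \<noteq> {}"
  shows "\<Inter>D \<in> proper_normal_subgroups G"
proof -
  obtain N where N: "N \<in> D" using assms(2) by blast
  have norm: "M \<lhd> G" "M \<noteq> carrier G" if "M \<in> D" for M
    using that assms(1) by (auto simp: proper_normal_subgroups_def normal_subgroups_def)
  have "N \<subset> carrier G"
    using norm[OF N] by (auto simp: normal_inv_iff dest: subgroup.subset)
  then have "\<Inter>D \<noteq> carrier G" using N by blast
  then show ?thesis
    using normal_Inter[OF assms(2) norm(1)]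
    by (simp add: proper_normal_subgroups_def normal_subgroups_def)
qed

theorem theorem1p1:
  fixes G :: "('a, 'b) monoid_scheme"
  assumes "group G"
    and "\<exists>H. finitely_generated_subgroup H G \<and> carrier G = normal_closure G H"
    and "\<exists>M. maximal_normal_subgroup M G"
  shows "spectral_space
    (subtopology (coarse_lower_topology G) (proper_normal_subgroups G))"
proof -
  interpret group G by fact
  obtain H where H: "finitely_generated_subgroup H G" "carrier G = normal_closure G H"
    using assms(2) by blast
  have "proper_normal_subgroups G \<subseteq> normal_subgroups G"
    by (auto simp: proper_normal_subgroups_def)
  then have "subtopology (coarse_lower_topology G) (proper_normal_subgroups G)
    = hull_kernel_topology (proper_normal_subgroups G)"
    by (simp add: coarse_lower_topology_eq_hull_kernel subtopology_hull_kernel)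
  moreover have "spectral_space (hull_kernel_topology (proper_normal_subgroups G))"
    using proper_normal_Inter proper_normal_directed_Union[OF H]
    by (intro spectral_space_hull_kernel) auto
  ultimately show ?thesis by simp
qed

end
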